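(* Let $A(n,m,\ell)$ be the number of overpartitions $\lambda$ of $n$ lying in the set $\mathscr{A}_{\{\overline{1}\}}^\veebar$ (defined below) such that $\sharp_{1,2}(\lambda)+2\sharp_{0,4}(\lambda)=m$ and $\sharp_{2,4}(\lambda)+\mathsf{O}(\lambda)=\ell$. Let $B(n,m,\ell)$ be the number of partitions of $n$ into distinct parts, none divisible by $4$, having exactly $m$ odd parts and exactly $\ell$ even parts. Then $A(n,m,\ell)=B(n,m,\ell)$ for all $n,m,\ell\ge 0$.
   Context: An overpartition of $n$ is a partition of $n$ in which the first occurrence of each distinct part value may be overlined. The set $\mathscr{A}_{\{\overline{1}\}}^\veebar$ consists of the overpartitions such that (1) only odd parts larger than $1$ may be overlined; (2) the difference between any two parts is at least $4$, and this inequality is strict (difference at least $5$) if the larger of the two parts is overlined or divisible by $4$, with the exception that $\overline{5}$ and $1$ may simultaneously appear as parts. For an overpartition $\lambda$, $\sharp_{a,M}(\lambda)$ is the number of parts of $\lambda$ (overlined or not) congruent to $a$ modulo $M$, and $\mathsf{O}(\lambda)$ is the number of overlined parts of $\lambda$. *)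

theory Defs
  imports Main "HOL-Library.Multiset"
begin

definition is_partition :: "nat \<Rightarrow> nat multiset \<Rightarrow> bool" where
  "is_partition n \<mu> \<longleftrightarrow> 0 \<notin># \<mu> \<and> sum_mset \<mu> = n"

text \<open>
  A part is a pair \<open>(k, b)\<close> of its value \<open>k\<close> and a flag \<open>b\<close> telling whether it is overlined.
  Only the first occurrence of a value may be overlined, so each value carries
  at most one overline; as the order of the parts is immaterial, this is the only constraint.
\<close>

type_synonym part = "nat \<times> bool"

abbreviation val :: "part \<Rightarrow> nat" where "val \<equiv> fst"

abbreviation overlined :: "part \<Rightarrow> bool" where "overlined \<equiv> snd"

definition is_overpartition :: "nat \<Rightarrow> part multiset \<Rightarrow> bool" where
  "is_overpartition n \<pi> \<longleftrightarrow>
     is_partition n (image_mset val \<pi>) \<and> (\<forall>k. count \<pi> (k, True) \<le> 1)"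

definition num_parts :: "nat \<Rightarrow> nat \<Rightarrow> part multiset \<Rightarrow> nat" where
  "num_parts a M \<pi> = size {#p \<in># \<pi>. val p mod M = a mod M#}"

definition num_overlined :: "part multiset \<Rightarrow> nat" where
  "num_overlined \<pi> = size {#p \<in># \<pi>. overlined p#}"

definition gap_ok :: "part \<Rightarrow> part \<Rightarrow> bool" where
  "gap_ok p q \<longleftrightarrow>
     val p \<ge> val q + 4 \<and>
     (overlined p \<or> 4 dvd val p \<longrightarrow>
        val p > val q + 4 \<or> (p = (5, True) \<and> q = (1, False)))"

text \<open>
  The second part \<open>q\<close> is drawn from \<open>\<pi> - {#p#}\<close>, so that two occurrences of the same part
  also count as two parts; equal values fail \<open>gap_ok\<close>.
\<close>

definition A_set :: "part multiset set" where
  "A_set = {\<pi>.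
     (\<exists>n. is_overpartition n \<pi>) \<and>
     (\<forall>p \<in># \<pi>. overlined p \<longrightarrow> odd (val p) \<and> val p > 1) \<and>
     (\<forall>p \<in># \<pi>. \<forall>q \<in># \<pi> - {#p#}. val p \<ge> val q \<longrightarrow> gap_ok p q)}"

definition count_A :: "nat \<Rightarrow> nat \<Rightarrow> nat \<Rightarrow> nat" where
  "count_A n m l = card {\<pi>. is_overpartition n \<pi> \<and> \<pi> \<in> A_set \<and>
     num_parts 1 2 \<pi> + 2 * num_parts 0 4 \<pi> = m \<and>
     num_parts 2 4 \<pi> + num_overlined \<pi> = l}"

definition count_B :: "nat \<Rightarrow> nat \<Rightarrow> nat \<Rightarrow> nat" where
  "count_B n m l = card {\<mu>. is_partition n \<mu> \<and> (\<forall>k. count \<mu> k \<le> 1) \<and>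
     (\<forall>k \<in># \<mu>. \<not> 4 dvd k) \<and>
     size {#k \<in># \<mu>. odd k#} = m \<and> size {#k \<in># \<mu>. even k#} = l}"

end

theory Submission
  imports Defs "HOL-Computational_Algebra.Formal_Power_Series" "HOL-Computational_Algebra.Polynomial"
begin

text \<open>
  Put \<open>a = xq, b = yq\<^sup>2, c = xq\<^sup>3, Q = q\<^sup>4\<close>, where \<open>q, x, y\<close> mark \<open>n, m, \<ell>\<close>. Then parts \<open>\<equiv> 0 mod 4\<close>
  carry the weight \<open>ac\<close> and overlined parts the weights \<open>ab\<close> or \<open>bc\<close> (times powers of \<open>Q\<close>), while
  the partitions into distinct parts not divisible by \<open>4\<close> have generating function \<open>\<Prod>(1 + aQ\<^sup>j)(1 + bQ\<^sup>j)(1 + cQ\<^sup>j)\<close>.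
  Bounding the largest part of the overpartitions gives a recurrence that is symmetric in
  \<open>a, b, c\<close> after a linear change of unknowns, and its solution \<open>Y\<^sub>n(a)\<close> satisfies
  \<open>Y\<^sub>n(a) + abc Q\<^bsup>2n-3\<^esup> Y\<^bsub>n-2\<^esub>(a) = Y\<^sub>n(aQ) + a(1 - Q\<^sup>n) Y\<^bsub>n-1\<^esub>(aQ) + abc Q\<^bsup>n-2\<^esup> Y\<^bsub>n-2\<^esub>(aQ)\<close>.
  Hence \<open>Y\<^sub>n(a) \<equiv> (1 + a) Y\<^sub>n(aQ)\<close> modulo \<open>Q\<^bsup>n-2\<^esup>\<close>. Iterating this in all three variables yields
  the product.
\<close>

unbundle fps_syntax

section \<open>The dilation \<open>z\<close> to \<open>Qz\<close> of formal power series\<close>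

definition dil :: "'r::comm_ring_1 \<Rightarrow> 'r fps \<Rightarrow> 'r fps" where
  "dil Q f = Abs_fps (\<lambda>n. Q ^ n * f $ n)"

lemma dil_nth [simp]: "dil Q f $ n = Q ^ n * f $ n"
  by (simp add: dil_def)

lemma dil_add: "dil Q (f + g) = dil Q f + dil Q g"
  and dil_diff: "dil Q (f - g) = dil Q f - dil Q g"
  and dil_const: "dil Q (fps_const c) = fps_const c"
  and dil_one: "dil Q 1 = 1"
  and dil_X: "dil Q fps_X = fps_const Q * fps_X"
  by (auto simp: fps_eq_iff algebra_simps fps_X_def)

lemma dil_mult: "dil Q (f * g) = dil Q f * dil Q g"
proof (rule fps_ext)
  fix n
  have "Q ^ n * (f $ i * g $ (n - i)) = (Q ^ i * f $ i) * (Q ^ (n - i) * g $ (n - i))"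
    if "i \<in> {0..n}" for i
  proof -
    have "Q ^ n = Q ^ i * Q ^ (n - i)"
      using that by (simp flip: power_add)
    then show ?thesis by (simp add: ac_simps)
  qed
  then show "dil Q (f * g) $ n = (dil Q f * dil Q g) $ n"
    by (simp add: fps_mult_nth sum_distrib_left)
qed

lemma dil_power: "dil Q (f ^ k) = dil Q f ^ k"
  by (induction k) (simp_all add: dil_one dil_mult)

lemma dil_dil: "dil P (dil Q f) = dil (P * Q) f"
  by (simp add: fps_eq_iff power_mult_distrib mult.assoc)

section \<open>The symmetric recurrence and the shift of one variable\<close>

text \<open>
  Let \<open>\<eta>\<close> shift a sequence by one place and let \<open>X = Q\<^bsup>n-1\<^esup>\<eta>\<close>, so that \<open>X\<eta> = Q\<eta>X\<close>. For the
  elementary symmetric functions \<open>e1, e2, e3\<close> of \<open>a, b, c\<close> the sequence below solves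
  \<open>(1 - aX)(1 - bX)(1 - cX) Y = \<eta>(1 + abX)(1 + acX)(1 + bcX) Y\<close> with sources \<open>1\<close> at place \<open>0\<close>
  and \<open>e3\<close> at place \<open>2\<close>; the latter is the trace of the exceptional pair of parts.
  On generating functions \<open>\<eta>\<close> is multiplication by \<open>z\<close> and \<open>X\<close> is \<open>z\<close> times the dilation \<open>z \<mapsto> Qz\<close>.
\<close>

fun sym_seq :: "'r::comm_ring_1 \<Rightarrow> 'r \<Rightarrow> 'r \<Rightarrow> 'r \<Rightarrow> nat \<Rightarrow> 'r" where
  "sym_seq e1 e2 e3 Q 0 = 1"
| "sym_seq e1 e2 e3 Q (Suc 0) = 1 + e1"
| "sym_seq e1 e2 e3 Q (Suc (Suc 0)) = (1 + e1 * Q) * sym_seq e1 e2 e3 Q 1 + e2 * (1 - Q) + e3"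
| "sym_seq e1 e2 e3 Q (Suc (Suc (Suc 0))) =
     (1 + e1 * Q^2) * sym_seq e1 e2 e3 Q 2 + e2 * (Q - Q^3) * sym_seq e1 e2 e3 Q 1 + (e3 * Q^3 + e1 * e3 * Q)"
| "sym_seq e1 e2 e3 Q (Suc (Suc (Suc (Suc n)))) =
     (1 + e1 * Q^(n+3)) * sym_seq e1 e2 e3 Q (n+3) + e2 * (Q^(n+2) - Q^(2*n+5)) * sym_seq e1 e2 e3 Q (n+2)
     + (e3 * Q^(3*n+6) + e1 * e3 * Q^(2*n+3)) * sym_seq e1 e2 e3 Q (n+1) + e3^2 * Q^(3*n+3) * sym_seq e1 e2 e3 Q n"

text \<open>Expanding the operator equation gives the coefficients \<open>e1, e2, e3\<close> on the
  left and \<open>e2, e1*e3, e3^2\<close> on the right, the latter being the elementary symmetric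
  functions of \<open>ab, ac, bc\<close>. The factors \<open>Q\<close> and \<open>Q^3\<close> arise
  from moving dilations past \<open>z\<close>: two applications of X give \<open>Q z^2\<close> and
  three give \<open>Q^3 z^3\<close>, times the iterated dilation.\<close>

lemma sym_seq_functional_equation:
  fixes e1 e2 e3 Q :: "'r::comm_ring_1"
  defines "D \<equiv> Abs_fps (sym_seq e1 e2 e3 Q)"
  shows "D = 1 + fps_const e3 * fps_X^2 + fps_X * D
    + (fps_const e1 * fps_X + fps_const e2 * fps_X^2) * dil Q D
    + fps_const Q * (fps_const (e1 * e3) * fps_X^3 - fps_const e2 * fps_X^2) * dil Q (dil Q D)
    + fps_const (Q^3) * (fps_const e3 * fps_X^3 + fps_const (e3^2) * fps_X^4) * dil Q (dil Q (dil Q D))"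
    (is "D = ?R")
proof (rule fps_ext)
  fix n
  have R: "?R = 1 + fps_const e3 * fps_X^2 + fps_X * D
    + fps_const e1 * (fps_X * dil Q D) + fps_const e2 * (fps_X^2 * dil Q D)
    + fps_const (Q * e1 * e3) * (fps_X^3 * dil Q (dil Q D))
    - fps_const (Q * e2) * (fps_X^2 * dil Q (dil Q D))
    + fps_const (Q^3 * e3) * (fps_X^3 * dil Q (dil Q (dil Q D)))
    + fps_const (Q^3 * e3^2) * (fps_X^4 * dil Q (dil Q (dil Q D)))"
    by (simp add: algebra_simps flip: fps_const_mult)
  consider "n = 0" | "n = 1" | "n = 2" | "n = 3" | m where "n = Suc (Suc (Suc (Suc m)))"
    by (metis One_nat_def not0_implies_Suc numeral_2_eq_2 numeral_3_eq_3)
  then show "D $ n = ?R $ n"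
  proof cases
    case 5
    then show ?thesis unfolding R
      by (simp add: D_def fps_X_power_mult_nth algebra_simps fps_X_power_nth
        power_add power_mult power2_eq_square power3_eq_cube numeral_eq_Suc)
  qed (unfold R, simp_all add: D_def fps_X_power_mult_nth fps_X_power_nth algebra_simps
        numeral_2_eq_2 numeral_3_eq_3)
qed

text \<open>The factor \<open>fps_X\<close> makes coefficient \<open>n\<close> of the right side
  depend only on coefficients of \<open>E\<close> below \<open>n\<close>. By induction these vanish,
  and \<open>Q\<close> cancels in a domain.\<close>

lemma dil_equation_unique:
  fixes E :: "'r::idom fps" and H :: "nat \<Rightarrow> 'r fps"
  assumes "Q \<noteq> 0" and eq: "fps_const Q * E = fps_X * (\<Sum>k\<in>K. H k * dil (Q ^ k) E)"
  shows "E = 0"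
proof -
  have "E $ n = 0" for n
  proof (induction n rule: less_induct)
    case (less n)
    have "(H k * dil (Q ^ k) E) $ m = 0" if "m < n" for k m
      unfolding fps_mult_nth using less that by (intro sum.neutral) auto
    then have "(fps_X * (\<Sum>k\<in>K. H k * dil (Q ^ k) E)) $ n = 0"
      by (simp add: fps_sum_nth)
    with eq have "(fps_const Q * E) $ n = 0" by simp
    with \<open>Q \<noteq> 0\<close> show ?case by simp
  qed
  then show ?thesis by (simp add: fps_eq_iff)
qed

text \<open>
  With \<open>p = (1 - bX)(1 - cX)\<close>, \<open>C = 1 + bcX\<close> and \<open>L(a) = (1 - aX) p(X) - \<eta> p(-aX) C\<close>, the operator
  \<open>(1 + abcX\<^sup>2)\<inverse> ((1 - aQX) + a\<eta>C)\<close> intertwines \<open>L(aQ)\<close> and \<open>L(a)\<close>, because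
  \<open>p(-aX) + a p(X) = (1 + a)(1 + abcX\<^sup>2)\<close>. The identity below states this with all denominators
  cleared; \<open>d k\<close> and \<open>d' k\<close> are the \<open>k\<close>-fold dilations of the two generating functions, \<open>P k\<close> and
  \<open>P' k\<close> their functional equations, and \<open>E k\<close> the relation to be proved.
\<close>

lemma intertwining_identity:
  fixes a b c Q z :: "'r::idom"
  fixes d d' :: "nat \<Rightarrow> 'r"
  assumes e: "e1 = a + b + c" "e2 = a*b + a*c + b*c" "e3 = a*b*c"
  assumes f: "f1 = a*Q + b + c" "f2 = a*b*Q + a*c*Q + b*c" "f3 = a*b*c*Q"
  assumes P: "\<And>k. P k = d k - 1 - e3 * (Q^k*z)^2 - Q^k*z * d k
    - (e1 * (Q^k*z) + e2 * (Q^k*z)^2) * d (k+1)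
    - Q * (e1 * e3 * (Q^k*z)^3 - e2 * (Q^k*z)^2) * d (k+2)
    - Q^3 * (e3 * (Q^k*z)^3 + e3^2 * (Q^k*z)^4) * d (k+3)"
  assumes P': "\<And>k. P' k = d' k - 1 - f3 * (Q^k*z)^2 - Q^k*z * d' k
    - (f1 * (Q^k*z) + f2 * (Q^k*z)^2) * d' (k+1)
    - Q * (f1 * f3 * (Q^k*z)^3 - f2 * (Q^k*z)^2) * d' (k+2)
    - Q^3 * (f3 * (Q^k*z)^3 + f3^2 * (Q^k*z)^4) * d' (k+3)"
  assumes E: "\<And>k. E k = d k + e3 * Q * (Q^k*z)^2 * d (k+2) - (1 + a*(Q^k*z)) * d' k
     - (e3*(Q^k*z)^2 - a*Q*(Q^k*z)) * d' (k+1)"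
  assumes A: "\<And>k. A k = E k - e1 * (Q^k*z) * E (k+1) + e2 * Q * (Q^k*z)^2 * E (k+2) - e3 * Q^3 * (Q^k*z)^3 * E (k+3)"
  assumes B: "\<And>k. B k = E k + e2 * (Q^k*z) * E (k+1) + e1 * e3 * Q * (Q^k*z)^2 * E (k+2) + e3^2 * Q^3 * (Q^k*z)^3 * E (k+3)"
  shows "Q * A 0 + e3 * z^2 * A 2 - Q * z * (B 0 + e3 * Q^3 * z^2 * B 2) =
    Q * P 0 + e3 * z^2 * (1 + Q^2) * P 2 + e3^2 * Q^5 * z^4 * P 4
    - Q * ((1 + a * z) * P' 0 + a * z * (b * c * z - 1) * P' 1)
    - e3 * z^2 * ((1 + a * Q^4 * z) * P' 2 + a * Q^2 * z * (b * c * Q^4 * z - 1) * P' 3)"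
  unfolding A B E P P' e f
  by (simp only: add_0 arith_simps power_0 mult_1_left power_one_right numeral_plus_one
      one_plus_numeral one_add_one) algebra

text \<open>The difference \<open>E 0\<close> of the two sides satisfies a homogeneous dilation
  equation by \<open>intertwining_identity\<close>, and such an equation has only the zero
  solution.\<close>

lemma sym_seq_shift_fps:
  fixes a b c Q :: "'r::idom"
  defines "D \<equiv> Abs_fps (sym_seq (a+b+c) (a*b+a*c+b*c) (a*b*c) Q)"
  defines "D' \<equiv> Abs_fps (sym_seq (a*Q+b+c) (a*b*Q+a*c*Q+b*c) (a*b*c*Q) Q)"
  assumes "Q \<noteq> 0"
  shows "D + fps_const (a*b*c*Q) * fps_X^2 * dil Q (dil Q D) =
    (1 + fps_const a * fps_X) * D' + (fps_const (a*b*c) * fps_X^2 - fps_const (a*Q) * fps_X) * dil Q D'"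
proof -
  define z :: "'r fps" where "z = fps_X"
  define A B C R where "A = fps_const a" and "B = fps_const b" and "C = fps_const c" and "R = fps_const Q"
  have [simp]: "dil 1 f = f" for f :: "'r fps"
    by (simp add: fps_eq_iff)
  note folds = A_def [symmetric] B_def [symmetric] C_def [symmetric] R_def [symmetric] z_def [symmetric]
    fps_const_add [symmetric] fps_const_mult [symmetric] fps_const_power [symmetric]
  note dils = dil_add dil_diff dil_one dil_mult dil_power dil_dil
  have [simp]: "dil (Q ^ k) A = A" "dil (Q ^ k) B = B" "dil (Q ^ k) C = C" "dil (Q ^ k) R = R"
     "dil (Q ^ k) z = R ^ k * z" for k
    by (simp_all add: A_def B_def C_def R_def z_def dil_const dil_X fps_const_power)
  define d where "d k = dil (Q ^ k) D" for k
  define d' where "d' k = dil (Q ^ k) D'" for k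
  define e1 e2 e3 f1 f2 f3 where e: "e1 = A + B + C" "e2 = A*B + A*C + B*C" "e3 = A*B*C"
    and f: "f1 = A*R + B + C" "f2 = A*B*R + A*C*R + B*C" "f3 = A*B*C*R"
  have [simp]: "dil (Q ^ k) e1 = e1" "dil (Q ^ k) e2 = e2" "dil (Q ^ k) e3 = e3"
   "dil (Q ^ k) f1 = f1" "dil (Q ^ k) f2 = f2" "dil (Q ^ k) f3 = f3" for k
    by (simp_all add: e f dils)
  define E where "E = (\<lambda>k. d k + e3 * R * (R^k*z)^2 * d (k+2) - (1 + A*(R^k*z)) * d' k
     - (e3*(R^k*z)^2 - A*R*(R^k*z)) * d' (k+1))"
  have E_dil: "E k = dil (Q ^ k) (E 0)" for k
    unfolding E_def d_def d'_def
    by (simp add: dils power_add power2_eq_square mult_ac)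
  define P where "P = (\<lambda>k. d k - 1 - e3 * (R^k*z)^2 - R^k*z * d k
    - (e1 * (R^k*z) + e2 * (R^k*z)^2) * d (k+1)
    - R * (e1 * e3 * (R^k*z)^3 - e2 * (R^k*z)^2) * d (k+2)
    - R^3 * (e3 * (R^k*z)^3 + e3^2 * (R^k*z)^4) * d (k+3))"
  define P' where "P' = (\<lambda>k. d' k - 1 - f3 * (R^k*z)^2 - R^k*z * d' k
    - (f1 * (R^k*z) + f2 * (R^k*z)^2) * d' (k+1)
    - R * (f1 * f3 * (R^k*z)^3 - f2 * (R^k*z)^2) * d' (k+2)
    - R^3 * (f3 * (R^k*z)^3 + f3^2 * (R^k*z)^4) * d' (k+3))"
  have P_dil: "P k = dil (Q ^ k) (P 0)" "P' k = dil (Q ^ k) (P' 0)" for k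
    unfolding P_def P'_def d_def d'_def
    by (simp_all add: dils power_add power2_eq_square power3_eq_cube mult_ac)
  have "P 0 = 0"
    using sym_seq_functional_equation [of "a+b+c" "a*b+a*c+b*c" "a*b*c" Q, folded D_def]
    unfolding P_def d_def e
    by (simp only: folds dil_dil) (simp add: algebra_simps power2_eq_square power3_eq_cube)
  moreover have "P' 0 = 0"
    using sym_seq_functional_equation [of "a*Q+b+c" "a*b*Q+a*c*Q+b*c" "a*b*c*Q" Q, folded D'_def]
    unfolding P'_def d'_def f
    by (simp only: folds dil_dil) (simp add: algebra_simps power2_eq_square power3_eq_cube)
  ultimately have P0: "P k = 0" "P' k = 0" for k
    using P_dil [of k] by (simp_all add: dil_def fps_eq_iff)
  define S where "S = (\<lambda>k. E k - e1 * (R^k*z) * E (k+1) + e2 * R * (R^k*z)^2 * E (k+2) - e3 * R^3 * (R^k*z)^3 * E (k+3))"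
  define T where "T = (\<lambda>k. E k + e2 * (R^k*z) * E (k+1) + e1 * e3 * R * (R^k*z)^2 * E (k+2) + e3^2 * R^3 * (R^k*z)^3 * E (k+3))"
  \<comment> \<open>All \<open>P k\<close> and \<open>P' k\<close> vanish, being dilations of the
    two functional equations, so the right side of the identity is zero.\<close>
  have "R * S 0 + e3 * z^2 * S 2 - R * z * (T 0 + e3 * R^3 * z^2 * T 2) = 0"
    using intertwining_identity [OF e f P_def [THEN fun_cong] P'_def [THEN fun_cong] E_def [THEN fun_cong]
      S_def [THEN fun_cong] T_def [THEN fun_cong]]
    by (simp add: P0)
  \<comment> \<open>Solved for \<open>E 0\<close>: every other term carries a factor
    \<open>z\<close>, the form to which uniqueness applies.\<close>
  then have "R * E 0 = z * (R * E 0 + (e1*R + e2*R*z) * E 1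
      + (e1*e3*R^2*z^2 - e2*R^2*z - e3*z + e3*R^4*z^2) * E 2
      + (e3*R^4*z^2 + e1*e3*R^2*z^2 + e3^2*R^4*z^3 + e2*e3*R^6*z^3) * E 3
      + (e1*e3^2*R^9*z^4 - e2*e3*R^5*z^3) * E 4 + (e3^2*R^9*z^4 + e3^3*R^13*z^5) * E 5)"
    unfolding S_def T_def
    by (simp only: add_0 arith_simps power_0 mult_1_left power_one_right numeral_plus_one
      one_plus_numeral one_add_one) algebra
  also have "\<dots> = z * (\<Sum>k\<in>{0..5}. [R, e1*R + e2*R*z, e1*e3*R^2*z^2 - e2*R^2*z - e3*z + e3*R^4*z^2,
      e3*R^4*z^2 + e1*e3*R^2*z^2 + e3^2*R^4*z^3 + e2*e3*R^6*z^3,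
      e1*e3^2*R^9*z^4 - e2*e3*R^5*z^3, e3^2*R^9*z^4 + e3^3*R^13*z^5] ! k * dil (Q ^ k) (E 0))"
    by (simp add: numeral_eq_Suc flip: E_dil)
  finally have "E 0 = 0"
    unfolding R_def z_def by (rule dil_equation_unique [OF \<open>Q \<noteq> 0\<close>])
  then show ?thesis
    unfolding E_def d_def d'_def e
    by (simp only: folds dil_dil) (simp add: algebra_simps power2_eq_square)
qed

section \<open>Congruence with the product modulo powers of Q\<close>

definition block_seq :: "'r::comm_ring_1 \<Rightarrow> 'r \<Rightarrow> 'r \<Rightarrow> 'r \<Rightarrow> nat \<Rightarrow> 'r" where
  "block_seq a b c Q = sym_seq (a+b+c) (a*b+a*c+b*c) (a*b*c) Q"

text \<open>Symmetry in the three parameters transfers every result on shifting \<open>a\<close> to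
  \<open>b\<close> and \<open>c\<close>.\<close>

lemma block_seq_swap: "block_seq a b c Q n = block_seq b a c Q n" "block_seq a b c Q n = block_seq c b a Q n"
  by (simp_all add: block_seq_def ac_simps)

lemma block_seq_shift:
  fixes a b c Q :: "'r::idom"
  assumes "Q \<noteq> 0"
  shows "block_seq a b c Q (n+2) + a*b*c * Q * Q^n * Q^n * block_seq a b c Q n =
    block_seq (a*Q) b c Q (n+2) + a * block_seq (a*Q) b c Q (n+1) - a * Q^(n+2) * block_seq (a*Q) b c Q (n+1)
      + a*b*c * Q^n * block_seq (a*Q) b c Q n"
proof -
  define D D' where "D = Abs_fps (block_seq a b c Q)" and "D' = Abs_fps (block_seq (a*Q) b c Q)"
  have "D + fps_const (a*b*c*Q) * (fps_X^2 * dil Q (dil Q D)) =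
    D' + fps_const a * (fps_X * D') + fps_const (a*b*c) * (fps_X^2 * dil Q D') - fps_const (a*Q) * (fps_X * dil Q D')"
    using sym_seq_shift_fps [OF assms, of a b c]
    by (simp add: D_def D'_def block_seq_def algebra_simps)
  then have "(D + fps_const (a*b*c*Q) * (fps_X^2 * dil Q (dil Q D))) $ (n+2) =
    (D' + fps_const a * (fps_X * D') + fps_const (a*b*c) * (fps_X^2 * dil Q D') - fps_const (a*Q) * (fps_X * dil Q D')) $ (n+2)"
    by simp
  then show ?thesis
    by (simp add: D_def D'_def fps_X_power_mult_nth algebra_simps mult_2 power_add)
qed

text \<open>Apart from the leading 1 in front of the previous term, every coefficient of the
  recurrence is divisible by \<open>Q^n\<close>; the smallest exponent, that of the
  \<open>e2\<close> term, is exactly \<open>n\<close>.\<close>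

lemma sym_seq_step_dvd:
  fixes Q :: "'r::idom"
  shows "Q ^ n dvd sym_seq e1 e2 e3 Q (n+2) - sym_seq e1 e2 e3 Q (n+1)"
proof -
  consider "n = 0" | "n = 1" | m where "n = Suc (Suc m)"
    by (metis One_nat_def not0_implies_Suc)
  then show ?thesis
  proof cases
    case 2
    have "sym_seq e1 e2 e3 Q 3 - sym_seq e1 e2 e3 Q 2 = Q *
       (e1 * Q * sym_seq e1 e2 e3 Q 2 + e2 * (1 - Q^2) * sym_seq e1 e2 e3 Q 1 + e3 * Q^2 + e1 * e3)"
      by (simp add: numeral_eq_Suc algebra_simps)
    with 2 show ?thesis by (simp add: numeral_eq_Suc)
  next
    case 3
    have "sym_seq e1 e2 e3 Q (n+2) - sym_seq e1 e2 e3 Q (n+1) = Q^n *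
       (e1 * Q * sym_seq e1 e2 e3 Q (m+3) + e2 * (1 - Q^(m+3)) * sym_seq e1 e2 e3 Q (m+2)
       + (e3 * Q^(2*m+4) + e1 * e3 * Q^(m+1)) * sym_seq e1 e2 e3 Q (m+1) + e3^2 * Q^(2*m+1) * sym_seq e1 e2 e3 Q m)"
    proof -
      have pw: "Q^(2*m) = (Q^m)^2" "Q^(3*m) = (Q^m)^3"
        by (simp_all add: mult.commute flip: power_mult)
      have sucs: "m+3 = Suc (Suc (Suc m))" "m+2 = Suc (Suc m)" "m+1 = Suc m" "n+1 = Suc (Suc (Suc m))"
        "n+2 = Suc (Suc (Suc (Suc m)))" "Q^n = Q^2 * Q^m"
        using 3 by (simp_all add: power2_eq_square)
      show ?thesis
        unfolding sucs sym_seq.simps(5) power_add pw power_Suc power_one_right by algebra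
    qed
    then show ?thesis by simp
  qed simp
qed

text \<open>Each increment of the sequence is a combination of \<open>e1, e2, e3\<close>. This
  disposes of the factor left over after many shifts, where all three are divisible by a high power
  of \<open>Q\<close>.\<close>

lemma sym_seq_dvd_minus_one:
  assumes "d dvd e1" "d dvd e2" "d dvd e3"
  shows "d dvd sym_seq e1 e2 e3 Q n - 1"
proof -
  have step: "d dvd sym_seq e1 e2 e3 Q (Suc n) - sym_seq e1 e2 e3 Q n" for n
    using assms
    by (cases "(e1, e2, e3, Q, n)" rule: sym_seq.cases)
      (simp_all add: algebra_simps power2_eq_square numeral_eq_Suc)
  show ?thesis
  proof (induction n)
    case (Suc n)
    then show ?case using dvd_add [OF step [of n] Suc] by simp
  qed simp
qed

text \<open>In \<open>block_seq_shift\<close> the terms with \<open>abc\<close> and the term with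
  \<open>Q^(n+2)\<close> vanish modulo \<open>Q^n\<close>; replacing place \<open>n+1\<close> by
  \<open>n+2\<close> in the remaining term \<open>a * block_seq (a*Q) b c Q (n+1)\<close> costs a
  multiple of \<open>Q^n\<close>.\<close>

lemma block_seq_shift_dvd:
  fixes a b c Q :: "'r::idom"
  assumes "Q \<noteq> 0"
  shows "Q ^ n dvd block_seq a b c Q (n+2) - (1 + a) * block_seq (a*Q) b c Q (n+2)"
proof -
  have "Q ^ n dvd block_seq (a*Q) b c Q (n+2) - block_seq (a*Q) b c Q (n+1)"
    unfolding block_seq_def by (rule sym_seq_step_dvd)
  then obtain g where "block_seq (a*Q) b c Q (n+2) - block_seq (a*Q) b c Q (n+1) = Q ^ n * g"
    by (rule dvdE)
  then have "a * block_seq (a*Q) b c Q (n+2) = a * block_seq (a*Q) b c Q (n+1) + a * (Q ^ n * g)"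
    by (metis add.commute diff_add_cancel distrib_left)
  with block_seq_shift [OF assms, of a b c n]
  have "block_seq a b c Q (n+2) - (1 + a) * block_seq (a*Q) b c Q (n+2) = Q ^ n *
    (a*b*c * block_seq (a*Q) b c Q n - a * g - a * Q^2 * block_seq (a*Q) b c Q (n+1) - a*b*c * Q^(n+1) * block_seq a b c Q n)"
    by (simp add: algebra_simps power2_eq_square)
  then show ?thesis by simp
qed

lemma dvd_diff_trans:
  fixes d :: "'r::comm_ring_1"
  assumes "d dvd x - y" "d dvd y - z" shows "d dvd x - z"
  using dvd_add [OF assms] by simp

lemma block_seq_shift_all_dvd:
  fixes a b c Q :: "'r::idom"
  assumes "Q \<noteq> 0"
  shows "Q ^ n dvd block_seq a b c Q (n+2) - (1 + a) * (1 + b) * (1 + c) * block_seq (a*Q) (b*Q) (c*Q) Q (n+2)"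
proof -
  have 1: "Q ^ n dvd block_seq a b c Q (n+2) - (1 + a) * block_seq (a*Q) b c Q (n+2)"
    by (rule block_seq_shift_dvd [OF assms])
  have 2: "Q ^ n dvd (1 + a) * block_seq (a*Q) b c Q (n+2) - (1 + a) * ((1 + b) * block_seq (a*Q) (b*Q) c Q (n+2))"
    using dvd_mult [OF block_seq_shift_dvd [OF assms, of n b "a*Q" c], of "1 + a"]
    by (simp only: block_seq_swap(1) [of "a*Q"] right_diff_distrib)
  have 3: "Q ^ n dvd (1 + a) * ((1 + b) * block_seq (a*Q) (b*Q) c Q (n+2)) -
      (1 + a) * ((1 + b) * ((1 + c) * block_seq (a*Q) (b*Q) (c*Q) Q (n+2)))"
    using dvd_mult [OF block_seq_shift_dvd [OF assms, of n c "b*Q" "a*Q"], of "(1 + a) * (1 + b)"]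
    by (simp only: block_seq_swap(2) [of "a*Q"] right_diff_distrib mult.assoc)
  show ?thesis
    using dvd_diff_trans [OF 1 dvd_diff_trans [OF 2 3]] by (simp only: mult.assoc)
qed

lemma block_seq_product_dvd:
  fixes a b c Q :: "'r::idom"
  assumes "Q \<noteq> 0" "n \<le> k"
  shows "Q ^ n dvd block_seq a b c Q (n+2) - (\<Prod>j<k. (1 + a*Q^j) * (1 + b*Q^j) * (1 + c*Q^j))"
proof -
  define p where "p j = (1 + a*Q^j) * (1 + b*Q^j) * (1 + c*Q^j)" for j
  have "Q ^ n dvd block_seq a b c Q (n+2) - (\<Prod>j<i. p j) * block_seq (a*Q^i) (b*Q^i) (c*Q^i) Q (n+2)" for i
  proof (induction i)
    case (Suc i)
    have "Q ^ n dvd (\<Prod>j<i. p j) * block_seq (a*Q^i) (b*Q^i) (c*Q^i) Q (n+2)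
        - (\<Prod>j<i. p j) * (p i * block_seq (a*Q^Suc i) (b*Q^Suc i) (c*Q^Suc i) Q (n+2))"
      using dvd_mult [OF block_seq_shift_all_dvd [OF \<open>Q \<noteq> 0\<close>, of n "a*Q^i" "b*Q^i" "c*Q^i"], of "\<Prod>j<i. p j"]
      by (simp only: right_diff_distrib p_def power_Suc mult_ac)
    from dvd_diff_trans [OF Suc this] show ?case
      by (simp add: mult_ac)
  qed simp
  moreover have "Q ^ k dvd block_seq (a*Q^k) (b*Q^k) (c*Q^k) Q (n+2) - 1"
    unfolding block_seq_def by (rule sym_seq_dvd_minus_one) (simp_all flip: distrib_right add: mult.assoc dvd_add)
  then have "Q ^ n dvd (\<Prod>j<k. p j) * block_seq (a*Q^k) (b*Q^k) (c*Q^k) Q (n+2) - (\<Prod>j<k. p j)"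
    using dvd_mult [of "Q ^ n" _ "\<Prod>j<k. p j"] dvd_trans [OF le_imp_power_dvd [OF \<open>n \<le> k\<close>]]
    by (metis mult.right_neutral right_diff_distrib)
  ultimately show ?thesis
    unfolding p_def by (rule dvd_diff_trans)
qed

section \<open>Nested polynomials in q, x, y as generating functions\<close>

definition mon :: "nat \<Rightarrow> nat \<Rightarrow> nat \<Rightarrow> int poly poly poly" where
  "mon n m l = monom (monom (monom 1 l) m) n"

lemma mon_mult: "mon n m l * mon n' m' l' = mon (n + n') (m + m') (l + l')"
  by (simp add: mon_def mult_monom)

lemma mon_0: "mon 0 0 0 = 1"
  by (simp add: mon_def)

lemma coeff_sum_mon:
  assumes "finite F"
  shows "coeff (coeff (coeff (\<Sum>x\<in>F. mon (f x) (g x) (h x)) n) m) l =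
    int (card {x \<in> F. f x = n \<and> g x = m \<and> h x = l})"
proof -
  have "coeff (coeff (coeff (\<Sum>x\<in>F. mon (f x) (g x) (h x)) n) m) l =
      (\<Sum>x\<in>F. if f x = n \<and> g x = m \<and> h x = l then 1 else 0)"
    unfolding coeff_sum by (intro sum.cong) (auto simp: mon_def)
  also have "\<dots> = int (card {x \<in> F. f x = n \<and> g x = m \<and> h x = l})"
    using assms by (simp flip: sum.inter_filter)
  finally show ?thesis .
qed

section \<open>Overpartitions classified by their largest part\<close>

definition part_ok :: "part \<Rightarrow> bool" where
  "part_ok p \<longleftrightarrow> val p > 0 \<and> (overlined p \<longrightarrow> odd (val p) \<and> val p > 1)"

text \<open>
  For \<open>5\<close> overlined the bound \<open>2\<close> admits exactly the exceptional \<open>1\<close>, since \<open>1\<close> cannot be overlined.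
\<close>

definition gap_bound :: "part \<Rightarrow> nat" where
  "gap_bound p = (if p = (5, True) then 2
     else if overlined p \<or> 4 dvd val p then val p - 4 else val p - 3)"

text \<open>This turns the gap condition into an upper bound on the smaller part, so that removing
  the largest part leaves a set of the same kind. Truncated subtraction is harmless: where it cuts
  off, the bound is 0 and both sides are false.\<close>

lemma gap_ok_iff:
  assumes "part_ok p" "part_ok q"
  shows "gap_ok p q \<longleftrightarrow> val q < gap_bound p"
proof (cases "p = (5, True)")
  case True
  with assms show ?thesis
    by (cases q) (auto simp: gap_ok_def gap_bound_def part_ok_def)
next
  case False
  then show ?thesis
    by (auto simp: gap_ok_def gap_bound_def)
qed

lemma gap_bound_le: "part_ok p \<Longrightarrow> gap_bound p \<le> val p"
  by (auto simp: gap_bound_def)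

lemma A_set_iff:
  "\<pi> \<in> A_set \<longleftrightarrow> (\<forall>p\<in>#\<pi>. part_ok p) \<and>
     (\<forall>p\<in>#\<pi>. \<forall>q\<in>#\<pi> - {#p#}. val q \<le> val p \<longrightarrow> gap_ok p q)"
proof -
  have "count \<pi> (k, True) \<le> 1"
    if "\<forall>p\<in>#\<pi>. \<forall>q\<in>#\<pi> - {#p#}. val q \<le> val p \<longrightarrow> gap_ok p q" for k
  proof (rule ccontr)
    assume "\<not> count \<pi> (k, True) \<le> 1"
    then have "(k, True) \<in># \<pi> - {#(k, True)#}" "(k, True) \<in># \<pi>"
      by (auto simp flip: count_greater_zero_iff)
    with that have "gap_ok (k, True) (k, True)" by blast
    then show False by (simp add: gap_ok_def)
  qed
  moreover have "0 \<notin># image_mset val \<pi> \<longleftrightarrow> (\<forall>p\<in>#\<pi>. val p > 0)"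
    by force
  ultimately show ?thesis
    by (auto simp: A_set_def part_ok_def is_overpartition_def is_partition_def)
qed

text \<open>For the converse, the gaps make every part of \<open>\<pi>\<close> strictly smaller than
  \<open>p\<close>, so \<open>p\<close> never occurs as the smaller member of a pair.\<close>

lemma add_mset_in_A_set_iff:
  assumes "\<forall>q\<in>#\<pi>. val q \<le> val p"
  shows "add_mset p \<pi> \<in> A_set \<longleftrightarrow> part_ok p \<and> \<pi> \<in> A_set \<and> (\<forall>q\<in>#\<pi>. gap_ok p q)"
proof
  assume l: "add_mset p \<pi> \<in> A_set"
  have "gap_ok r q" if "r \<in># \<pi>" "q \<in># \<pi> - {#r#}" "val q \<le> val r" for r q
  proof -
    have "q \<in># add_mset p \<pi> - {#r#}"
      using that by (cases "r = p") (auto dest: in_diffD)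
    with l that show ?thesis by (auto simp: A_set_iff)
  qed
  moreover have "gap_ok p q" if "q \<in># \<pi>" for q
    using l that assms by (auto simp: A_set_iff)
  ultimately show "part_ok p \<and> \<pi> \<in> A_set \<and> (\<forall>q\<in>#\<pi>. gap_ok p q)"
    using l by (auto simp: A_set_iff)
next
  assume r: "part_ok p \<and> \<pi> \<in> A_set \<and> (\<forall>q\<in>#\<pi>. gap_ok p q)"
  then have less: "val q < val p" if "q \<in># \<pi>" for q
    using that by (auto simp: gap_ok_def)
  have "gap_ok s t" if "s \<in># add_mset p \<pi>" "t \<in># add_mset p \<pi> - {#s#}" "val t \<le> val s" for s t
  proof (cases "s = p")
    case True
    with r that show ?thesis by auto
  next
    case False
    with that have "s \<in># \<pi>" "t \<in># add_mset p (\<pi> - {#s#})" by auto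
    moreover have "t \<noteq> p" using less [OF \<open>s \<in># \<pi>\<close>] that by auto
    ultimately show ?thesis using r that by (auto simp: A_set_iff)
  qed
  with r show "add_mset p \<pi> \<in> A_set" by (auto simp: A_set_iff)
qed

definition A_below :: "nat \<Rightarrow> part multiset set" where
  "A_below N = {\<pi> \<in> A_set. \<forall>p\<in>#\<pi>. val p < N}"

lemma A_below_0: "A_below 0 = {{#}}"
proof -
  have "\<pi> = {#}" if "\<forall>p\<in>#\<pi>. val p < 0" for \<pi> :: "part multiset"
    using that by (cases \<pi>) auto
  then show ?thesis by (auto simp: A_below_def A_set_iff)
qed

lemma A_below_containing:
  "{\<pi> \<in> A_below (Suc (val p)). p \<in># \<pi>} =
     (if part_ok p then add_mset p ` A_below (gap_bound p) else {})"
proof -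
  have *: "add_mset p \<sigma> \<in> A_below (Suc (val p)) \<longleftrightarrow> part_ok p \<and> \<sigma> \<in> A_below (gap_bound p)" for \<sigma>
  proof
    assume l: "add_mset p \<sigma> \<in> A_below (Suc (val p))"
    then have "part_ok p \<and> \<sigma> \<in> A_set \<and> (\<forall>q\<in>#\<sigma>. gap_ok p q)"
      using add_mset_in_A_set_iff [of \<sigma> p] by (auto simp: A_below_def less_Suc_eq_le)
    then show "part_ok p \<and> \<sigma> \<in> A_below (gap_bound p)"
      using gap_ok_iff [of p] by (auto simp: A_below_def A_set_iff)
  next
    assume r: "part_ok p \<and> \<sigma> \<in> A_below (gap_bound p)"
    then have "val q < val p" if "q \<in># \<sigma>" for q
      using gap_bound_le [of p] that by (force simp: A_below_def)
    moreover have "gap_ok p q" if "q \<in># \<sigma>" for q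
      using r that gap_ok_iff [of p q] by (auto simp: A_below_def A_set_iff)
    ultimately show "add_mset p \<sigma> \<in> A_below (Suc (val p))"
      using r add_mset_in_A_set_iff [of \<sigma> p] by (force simp: A_below_def)
  qed
  have "\<pi> \<in> A_below (Suc (val p)) \<and> p \<in># \<pi> \<longleftrightarrow> part_ok p \<and> \<pi> \<in> add_mset p ` A_below (gap_bound p)" for \<pi>
    using * by (auto simp: image_iff dest!: multi_member_split)
  then show ?thesis by auto
qed

lemma A_below_Suc:
  "A_below (Suc N) = A_below N \<union> {\<pi> \<in> A_below (Suc N). (N, False) \<in># \<pi>}
     \<union> {\<pi> \<in> A_below (Suc N). (N, True) \<in># \<pi>}"
proof -
  have "val p < N" if "val p < Suc N" "p \<noteq> (N, False)" "p \<noteq> (N, True)" for p :: part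
    using that by (cases p) (auto simp: less_Suc_eq)
  then show ?thesis
    by (auto simp: A_below_def less_Suc_eq)
qed

lemma finite_A_below: "finite (A_below N)"
proof (induction N rule: less_induct)
  case (less N)
  show ?case
  proof (cases N)
    case (Suc k)
    have "finite {\<pi> \<in> A_below (Suc k). p \<in># \<pi>}" if "val p = k" for p
      using A_below_containing [of p] less [of "gap_bound p"] gap_bound_le [of p] that Suc by auto
    then show ?thesis
      unfolding Suc by (subst A_below_Suc) (use less Suc in auto)
  qed (simp add: A_below_0)
qed

lemma A_below_disjoint:
  assumes "\<pi> \<in> A_set" "(N, False) \<in># \<pi>" shows "(N, True) \<notin># \<pi>"
proof
  assume "(N, True) \<in># \<pi>"
  with assms have "(N, True) \<in># \<pi> - {#(N, False)#}"
    by (auto dest!: multi_member_split)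
  with assms have "gap_ok (N, False) (N, True)" by (auto simp: A_set_iff)
  then show False by (simp add: gap_ok_def)
qed

definition weight :: "part \<Rightarrow> int poly poly poly" where
  "weight p = mon (val p) (of_bool (odd (val p)) + 2 * of_bool (4 dvd val p))
     (of_bool (val p mod 4 = 2) + of_bool (overlined p))"

definition A_gf :: "nat \<Rightarrow> int poly poly poly" where
  "A_gf N = (\<Sum>\<pi>\<in>A_below N. \<Prod>p\<in>#\<pi>. weight p)"

lemma A_gf_0: "A_gf 0 = 1"
  by (simp add: A_gf_def A_below_0)

text \<open>The value \<open>N\<close> is absent, present plain or present overlined. The last two
  exclude each other, since equal values have gap 0.\<close>

lemma A_gf_Suc:
  "A_gf (Suc N) = A_gf N
     + (if part_ok (N, False) then weight (N, False) * A_gf (gap_bound (N, False)) else 0)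
     + (if part_ok (N, True) then weight (N, True) * A_gf (gap_bound (N, True)) else 0)"
proof -
  define C where "C p = {\<pi> \<in> A_below (Suc (val p)). p \<in># \<pi>}" for p
  define w where "w \<pi> = (\<Prod>p\<in>#\<pi>. weight p)" for \<pi>
  have C: "sum w (C p) = (if part_ok p then weight p * A_gf (gap_bound p) else 0)" for p
    by (simp add: C_def A_below_containing A_gf_def sum.reindex inj_on_def w_def sum_distrib_left)
  have "A_below (Suc N) = (A_below N \<union> C (N, False)) \<union> C (N, True)"
    using A_below_Suc [of N] by (simp add: C_def)
  moreover have "finite (C p)" for p
    using finite_A_below by (simp add: C_def)
  moreover have "A_below N \<inter> C (N, False) = {}" "(A_below N \<union> C (N, False)) \<inter> C (N, True) = {}"
    using A_below_disjoint [of _ N] by (fastforce simp: C_def A_below_def)+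
  ultimately have "sum w (A_below (Suc N)) = sum w (A_below N) + sum w (C (N, False)) + sum w (C (N, True))"
    using finite_A_below [of N] by (metis finite_UnI sum.union_disjoint)
  then show ?thesis
    by (simp add: C A_gf_def flip: w_def)
qed

lemma prod_weight:
  "(\<Prod>p\<in>#\<pi>. weight p) = mon (sum_mset (image_mset val \<pi>))
     (num_parts 1 2 \<pi> + 2 * num_parts 0 4 \<pi>) (num_parts 2 4 \<pi> + num_overlined \<pi>)"
proof (induction \<pi>)
  case (add p \<pi>)
  have "num_parts 1 2 (add_mset p \<pi>) = of_bool (odd (val p)) + num_parts 1 2 \<pi>"
    "num_parts 0 4 (add_mset p \<pi>) = of_bool (4 dvd val p) + num_parts 0 4 \<pi>"
    "num_parts 2 4 (add_mset p \<pi>) = of_bool (val p mod 4 = 2) + num_parts 2 4 \<pi>"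
    "num_overlined (add_mset p \<pi>) = of_bool (overlined p) + num_overlined \<pi>"
    by (simp_all add: num_parts_def num_overlined_def odd_iff_mod_2_eq_one dvd_eq_mod_eq_0)
  then show ?case
    by (simp only: image_mset_add_mset prod_mset.add_mset sum_mset.add_mset add.IH
        weight_def [of p] mon_mult distrib_left add_ac)
qed (simp add: num_parts_def num_overlined_def mon_0)

text \<open>No part exceeds the sum \<open>n\<close>, so the bound \<open>N\<close> excludes nothing
  at this coefficient.\<close>

lemma coeff_A_gf:
  assumes "n < N"
  shows "coeff (coeff (coeff (A_gf N) n) m) l = int (count_A n m l)"
proof -
  have "val p < N" if "p \<in># \<pi>" "sum_mset (image_mset val \<pi>) = n" for p \<pi>
    using that assms multi_member_split [of p \<pi>] by auto
  then have "{\<pi> \<in> A_below N. sum_mset (image_mset val \<pi>) = n \<and>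
      num_parts 1 2 \<pi> + 2 * num_parts 0 4 \<pi> = m \<and> num_parts 2 4 \<pi> + num_overlined \<pi> = l} =
    {\<pi>. is_overpartition n \<pi> \<and> \<pi> \<in> A_set \<and>
     num_parts 1 2 \<pi> + 2 * num_parts 0 4 \<pi> = m \<and>
     num_parts 2 4 \<pi> + num_overlined \<pi> = l}"
    by (auto simp: A_below_def A_set_def is_overpartition_def is_partition_def)
  then show ?thesis
    unfolding A_gf_def prod_weight
    by (simp add: coeff_sum_mon finite_A_below count_A_def)
qed

section \<open>Partitions into distinct parts not divisible by 4\<close>

definition B_below :: "nat \<Rightarrow> nat multiset set" where
  "B_below N = {\<mu>. (\<forall>k. count \<mu> k \<le> 1) \<and> (\<forall>k\<in>#\<mu>. \<not> 4 dvd k \<and> k < N)}"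

lemma B_below_0: "B_below 0 = {{#}}"
proof -
  have "\<mu> = {#}" if "\<forall>k\<in>#\<mu>. k < 0" for \<mu> :: "nat multiset"
    using that by (cases \<mu>) auto
  then show ?thesis by (auto simp: B_below_def)
qed

lemma B_below_Suc:
  "B_below (Suc N) = B_below N \<union> (if 4 dvd N then {} else add_mset N ` B_below N)"
proof -
  have "\<mu> \<in> B_below (Suc N) \<longleftrightarrow> \<mu> \<in> B_below N \<or> \<not> 4 dvd N \<and> \<mu> \<in> add_mset N ` B_below N" for \<mu>
  proof (cases "N \<in># \<mu>")
    case True
    then obtain \<sigma> where \<mu>: "\<mu> = add_mset N \<sigma>" by (auto dest: multi_member_split)
    have *: "(\<forall>k. count (add_mset N \<sigma>) k \<le> 1) \<longleftrightarrow> (\<forall>k. count \<sigma> k \<le> 1) \<and> N \<notin># \<sigma>"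
    proof
      assume l: "\<forall>k. count (add_mset N \<sigma>) k \<le> 1"
      then have "count \<sigma> k \<le> 1" for k
        by (metis count_add_mset le_SucI le_trans not_less_eq_eq)
      moreover have "N \<notin># \<sigma>"
        using l [rule_format, of N] by (simp add: not_in_iff)
      ultimately show "(\<forall>k. count \<sigma> k \<le> 1) \<and> N \<notin># \<sigma>" by simp
    qed (simp add: not_in_iff)
    have "x \<noteq> N" if "x \<in># \<sigma>" "N \<notin># \<sigma>" for x
      using that by auto
    then show ?thesis
      unfolding \<mu> B_below_def mem_Collect_eq * by (auto simp: less_Suc_eq image_iff)
  next
    case False
    then show ?thesis by (auto simp: B_below_def less_Suc_eq)
  qed
  then show ?thesis by auto
qed

lemma finite_B_below: "finite (B_below N)"
  by (induction N) (auto simp: B_below_0 B_below_Suc)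

definition B_weight :: "nat \<Rightarrow> int poly poly poly" where
  "B_weight k = mon k (of_bool (odd k)) (of_bool (even k))"

definition B_gf :: "nat \<Rightarrow> int poly poly poly" where
  "B_gf N = (\<Sum>\<mu>\<in>B_below N. \<Prod>k\<in>#\<mu>. B_weight k)"

lemma B_gf_0: "B_gf 0 = 1"
  by (simp add: B_gf_def B_below_0)

lemma B_gf_Suc: "B_gf (Suc N) = (if 4 dvd N then 1 else 1 + B_weight N) * B_gf N"
proof -
  have "B_below N \<inter> add_mset N ` B_below N = {}"
    by (auto simp: B_below_def)
  then show ?thesis
    by (simp add: B_gf_def B_below_Suc sum.union_disjoint finite_B_below sum.reindex inj_on_def
        sum_distrib_left sum.distrib distrib_right)
qed

lemma prod_B_weight:
  "(\<Prod>k\<in>#\<mu>. B_weight k) = mon (sum_mset \<mu>) (size {#k \<in># \<mu>. odd k#}) (size {#k \<in># \<mu>. even k#})"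
  by (induction \<mu>) (auto simp: mon_0 B_weight_def mon_mult)

lemma coeff_B_gf:
  assumes "n < N"
  shows "coeff (coeff (coeff (B_gf N) n) m) l = int (count_B n m l)"
proof -
  have "k < N" if "k \<in># \<mu>" "sum_mset \<mu> = n" for k \<mu>
    using that assms multi_member_split [of k \<mu>] by auto
  \<comment> \<open>Positivity of the parts comes from 0 being a multiple of 4.\<close>
  moreover have "0 \<notin># \<mu>" if "\<forall>k\<in>#\<mu>. \<not> 4 dvd k" for \<mu> :: "nat multiset"
    using that by fastforce
  ultimately have "{\<mu> \<in> B_below N. sum_mset \<mu> = n \<and> size {#k \<in># \<mu>. odd k#} = m \<and> size {#k \<in># \<mu>. even k#} = l} =
    {\<mu>. is_partition n \<mu> \<and> (\<forall>k. count \<mu> k \<le> 1) \<and> (\<forall>k \<in># \<mu>. \<not> 4 dvd k) \<and>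
     size {#k \<in># \<mu>. odd k#} = m \<and> size {#k \<in># \<mu>. even k#} = l}"
    by (auto simp: B_below_def is_partition_def)
  then show ?thesis
    unfolding B_gf_def prod_B_weight
    by (simp add: coeff_sum_mon finite_B_below count_B_def)
qed

section \<open>Solving the recurrence and comparing coefficients\<close>

lemma block_seq_0: "block_seq a b c Q 0 = 1"
  by (simp add: block_seq_def)

text \<open>
  The intended \<open>t n, u n, v n, w n\<close> count by largest part at most \<open>4n - 3, 4n - 2, 4n - 1, 4n\<close>.
  The value \<open>w 0 = 1 + a\<close> instead of \<open>1\<close> encodes the exceptional pair.
\<close>

lemma block_recurrence_solution:
  fixes a b c Q :: "'r::idom" and t u v w :: "nat \<Rightarrow> 'r"
  assumes init: "u 0 = 1" "v 0 = 1" "w 0 = 1 + a" "t 1 = 1 + a"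
    and t: "\<And>n. t (n+2) = w (n+1) + a * Q^(n+1) * t (n+1) + b * c * Q^n * w n"
    and u: "\<And>n. u (n+1) = t (n+1) + b * Q^n * u n"
    and v: "\<And>n. v (n+1) = u (n+1) + c * Q^n * v n + a * b * Q^n * u n"
    and w: "\<And>n. w (n+1) = v (n+1) + a * c * Q^n * v n"
  shows "u (n+1) = block_seq a b c Q (n+1) - c * Q^n * block_seq a b c Q n \<and>
    v (n+1) = block_seq a b c Q (n+1) + a * b * Q^n * block_seq a b c Q n"
proof -
  have T: "t (n+1) = u (n+1) - b * Q^n * u n" for n
    using u [of n] by simp
  \<comment> \<open>Eliminating \<open>t\<close> and \<open>w\<close> leaves a recurrence in
    \<open>u\<close> and \<open>v\<close> alone.\<close>
  have U: "u (n+3) = v (n+2) + a*c*Q^(n+1) * v (n+1) + b*Q^(n+2) * u (n+2)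
      + a*Q^(n+2) * (u (n+2) - b*Q^(n+1) * u (n+1)) + b*c*Q^(n+1) * (v (n+1) + a*c*Q^n * v n)" for n
    using u [of "n+2"] t [of "n+1"] w [of "n+1"] w [of n] T [of "n+1"]
    by (simp add: numeral_eq_Suc)
  show ?thesis
  \<comment> \<open>In operator form the claim is u = (1 - cX)Y and v = (1 + abX)Y. The recurrence
    (1 - cX)v = (1 + abX)u for \<open>v\<close> is then automatic, and only \<open>u\<close> needs
    real work.\<close>
  proof (induction n rule: less_induct)
    case (less n)
    have un: "u (n+1) = block_seq a b c Q (n+1) - c * Q^n * block_seq a b c Q n"
    proof -
      \<comment> \<open>From \<open>n = 3\<close> on, \<open>U\<close> involves only values covered
        by the induction hypothesis, and the sequence obeys its uniform recurrence. The initial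
        values and the exceptional source enter in the smaller cases.\<close>
      consider "n = 0" | "n = 1" | "n = 2" | m where "n = m+3"
        by (metis One_nat_def add.commute add_Suc add_0 not0_implies_Suc numeral_2_eq_2 numeral_3_eq_3)
      then show ?thesis
      proof cases
        case 1
        then show ?thesis
          using u [of 0] init by (simp add: block_seq_def)
      next
        case 2
        have "u 2 = v 1 + a*c + a*Q * (1 + a) + b*c * (1 + a) + b*Q * u 1"
          using t [of 0] u [of 1] w [of 0] init by (simp add: numeral_2_eq_2)
        moreover have "u 1 = block_seq a b c Q 1 - c" "v 1 = block_seq a b c Q 1 + a * b"
          using less [of 0] 2 by (simp_all add: block_seq_0)
        ultimately have "u 2 = block_seq a b c Q 2 - c * Q * block_seq a b c Q 1"
          by (simp add: block_seq_def numeral_2_eq_2 algebra_simps)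
        then show ?thesis using 2 by (simp add: numeral_2_eq_2)
      next
        case 3
        have "u 1 = block_seq a b c Q 1 - c" "v 1 = block_seq a b c Q 1 + a * b"
          "u 2 = block_seq a b c Q 2 - c * Q * block_seq a b c Q 1" "v 2 = block_seq a b c Q 2 + a * b * Q * block_seq a b c Q 1"
          using less [of 0] less [of 1] 3 by (simp_all add: block_seq_0 numeral_2_eq_2)
        then have "u 3 = block_seq a b c Q 3 - c * Q^2 * block_seq a b c Q 2"
          using U [of 0] init by (simp add: block_seq_def numeral_eq_Suc algebra_simps)
        then show ?thesis using 3 by (simp add: numeral_eq_Suc)
      next
        case 4
        have pw: "Q^(2*m) = (Q^m)^2" "Q^(3*m) = (Q^m)^3"
          by (simp_all add: mult.commute flip: power_mult)
        have "u (m+1) = block_seq a b c Q (m+1) - c * Q^m * block_seq a b c Q m"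
          "v (m+1) = block_seq a b c Q (m+1) + a * b * Q^m * block_seq a b c Q m"
          "u (m+2) = block_seq a b c Q (m+2) - c * Q^(m+1) * block_seq a b c Q (m+1)"
          "v (m+2) = block_seq a b c Q (m+2) + a * b * Q^(m+1) * block_seq a b c Q (m+1)"
          "u (m+3) = block_seq a b c Q (m+3) - c * Q^(m+2) * block_seq a b c Q (m+2)"
          "v (m+3) = block_seq a b c Q (m+3) + a * b * Q^(m+2) * block_seq a b c Q (m+2)"
          using less [of m] less [of "m+1"] less [of "m+2"] 4 by (simp_all add: numeral_eq_Suc)
        note IH = this
        have Z4: "block_seq a b c Q (m+4) = (1 + (a+b+c) * Q^(m+3)) * block_seq a b c Q (m+3)
            + (a*b+a*c+b*c) * (Q^(m+2) - Q^(2*m+5)) * block_seq a b c Q (m+2)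
            + (a*b*c * Q^(3*m+6) + (a+b+c) * (a*b*c) * Q^(2*m+3)) * block_seq a b c Q (m+1)
            + (a*b*c)^2 * Q^(3*m+3) * block_seq a b c Q m"
          using sym_seq.simps(5) by (simp add: block_seq_def numeral_eq_Suc)
        have "u (m+4) = v (m+3) + a*c*Q^(m+2) * v (m+2) + b*Q^(m+3) * u (m+3)
           + a*Q^(m+3) * (u (m+3) - b*Q^(m+2) * u (m+2)) + b*c*Q^(m+2) * (v (m+2) + a*c*Q^(m+1) * v (m+1))"
          using U [of "m+1"] by (simp add: numeral_eq_Suc)
        also have "\<dots> = block_seq a b c Q (m+4) - c * Q^(m+3) * block_seq a b c Q (m+3)"
          unfolding IH Z4 power_add pw power_one_right by algebra
        finally show ?thesis using 4 by (simp add: numeral_eq_Suc)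
      qed
    qed
    moreover have "v (n+1) = block_seq a b c Q (n+1) + a * b * Q^n * block_seq a b c Q n"
    proof (cases n)
      case 0
      then show ?thesis using un v [of 0] init by (simp add: block_seq_0)
    next
      case (Suc m)
      have uv: "u n = block_seq a b c Q n - c * Q^m * block_seq a b c Q m" "v n = block_seq a b c Q n + a * b * Q^m * block_seq a b c Q m"
        using less [of m] Suc by simp_all
      show ?thesis
        unfolding v [of n] un uv by (simp add: algebra_simps)
    qed
    ultimately show ?case ..
  qed
qed

lemma mon_power: "mon 4 0 0 ^ n = mon (4 * n) 0 0"
  by (induction n) (simp_all add: mon_0 mon_mult)

lemma A_gf_Suc_odd:
  assumes "odd k" "k > 1"
  shows "A_gf (Suc k) = A_gf k + mon k 1 0 * A_gf (k - 3) + mon k 1 1 * A_gf (if k = 5 then 2 else k - 4)"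
proof -
  have "k mod 4 \<noteq> 2" "\<not> 4 dvd k" using \<open>odd k\<close> by presburger+
  with assms show ?thesis
    by (simp add: A_gf_Suc part_ok_def gap_bound_def weight_def)
qed

lemma A_gf_Suc_2_mod_4:
  assumes "k mod 4 = 2"
  shows "A_gf (Suc k) = A_gf k + mon k 0 1 * A_gf (k - 3)"
proof -
  have "even k" "\<not> 4 dvd k" "k > 0" using assms by presburger+
  with assms show ?thesis
    by (simp add: A_gf_Suc part_ok_def gap_bound_def weight_def)
qed

lemma A_gf_Suc_0_mod_4:
  assumes "4 dvd k" "k > 0"
  shows "A_gf (Suc k) = A_gf k + mon k 2 0 * A_gf (k - 4)"
proof -
  have "even k" "k mod 4 \<noteq> 2" using assms by presburger+
  with assms show ?thesis
    by (simp add: A_gf_Suc part_ok_def gap_bound_def weight_def numeral_2_eq_2)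
qed

lemma A_gf_eq_block_seq:
  defines "a \<equiv> mon 1 1 0" and "b \<equiv> mon 2 0 1" and "c \<equiv> mon 3 1 0" and "Q \<equiv> mon 4 0 0"
  shows "A_gf (4 * n + 3) = block_seq a b c Q (n+1) - c * Q^n * block_seq a b c Q n"
proof -
  have *: "a * Q^(n+1) = mon (4 * n + 5) 1 0" "b * c * Q^n = mon (4 * n + 5) 1 1"
    "b * Q^n = mon (4 * n + 2) 0 1" "c * Q^n = mon (4 * n + 3) 1 0"
    "a * b * Q^n = mon (4 * n + 3) 1 1" "a * c * Q^n = mon (4 * n + 4) 2 0" for n
    unfolding a_def b_def c_def Q_def mon_power mon_mult
    by (simp_all add: numeral_eq_Suc)
  define t where "t n = A_gf (4 * n - 2)" for n
  define u where "u n = A_gf (4 * n - 1)" for n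
  define v where "v n = A_gf (4 * n)" for n
  \<comment> \<open>Here \<open>A_gf 2\<close> counts what may lie below an overlined 5: nothing, or
    a single 1. In \<open>t 0\<close> and \<open>u 0\<close> truncated subtraction yields
    \<open>A_gf 0\<close>.\<close>
  define w where "w n = (if n = 0 then A_gf 2 else A_gf (4 * n + 1))" for n
  have A2: "A_gf 2 = 1 + a"
    using A_gf_Suc [of 0] A_gf_Suc [of 1]
    by (simp add: A_gf_0 numeral_2_eq_2 part_ok_def weight_def gap_bound_def a_def)
  have "u (n+1) = block_seq a b c Q (n+1) - c * Q^n * block_seq a b c Q n \<and>
    v (n+1) = block_seq a b c Q (n+1) + a * b * Q^n * block_seq a b c Q n"
  proof (rule block_recurrence_solution)
    fix n :: nat
    have mods: "(4 * n + 2) mod 4 = 2" "odd (4 * n + 5)" "odd (4 * n + 3)" "4 dvd 4 * n + 4"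
      by presburger+
    have eqs: "Suc (4 * n + 5) = 4 * n + 6" "Suc (4 * n + 4) = 4 * n + 5"
      "Suc (4 * n + 3) = 4 * n + 4" "Suc (4 * n + 2) = 4 * n + 3"
      "4 * n + 5 - 3 = 4 * n + 2" "4 * n + 4 - 4 = 4 * n" "4 * n + 3 - 3 = 4 * n"
      "(if 4 * n + 3 = 5 then 2 else 4 * n + 3 - 4) = 4 * n - 1" "4 * n + 2 - 3 = 4 * n - 1"
      "(if 4 * n + 5 = 5 then 2 else 4 * n + 5 - 4) = (if n = 0 then 2 else 4 * n + 1)"
      by auto
    have tuvw: "t (n+2) = A_gf (4 * n + 6)" "t (n+1) = A_gf (4 * n + 2)" "u (n+1) = A_gf (4 * n + 3)"
      "u n = A_gf (4 * n - 1)" "v (n+1) = A_gf (4 * n + 4)" "v n = A_gf (4 * n)"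
      "w (n+1) = A_gf (4 * n + 5)" "w n = A_gf (if n = 0 then 2 else 4 * n + 1)"
      by (simp_all add: t_def u_def v_def w_def add.commute)
    show "t (n+2) = w (n+1) + a * Q^(n+1) * t (n+1) + b * c * Q^n * w n"
      using A_gf_Suc_odd [OF mods(2)] unfolding eqs tuvw * by simp
    show "u (n+1) = t (n+1) + b * Q^n * u n"
      using A_gf_Suc_2_mod_4 [OF mods(1)] unfolding eqs tuvw * .
    show "v (n+1) = u (n+1) + c * Q^n * v n + a * b * Q^n * u n"
      using A_gf_Suc_odd [OF mods(3)] unfolding eqs tuvw * by simp
    show "w (n+1) = v (n+1) + a * c * Q^n * v n"
      using A_gf_Suc_0_mod_4 [OF mods(4)] unfolding eqs tuvw * by simp
  qed (simp_all add: t_def u_def v_def w_def A_gf_0 A2)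
  then show ?thesis by (simp add: u_def add.commute)
qed

lemma B_gf_eq_prod:
  defines "a \<equiv> mon 1 1 0" and "b \<equiv> mon 2 0 1" and "c \<equiv> mon 3 1 0" and "Q \<equiv> mon 4 0 0"
  shows "B_gf (4 * k) = (\<Prod>j<k. (1 + a * Q^j) * (1 + b * Q^j) * (1 + c * Q^j))"
proof (induction k)
  case (Suc k)
  have *: "a * Q^k = B_weight (4 * k + 1)" "b * Q^k = B_weight (4 * k + 2)" "c * Q^k = B_weight (4 * k + 3)"
    unfolding a_def b_def c_def Q_def mon_power mon_mult B_weight_def by (simp_all add: add.commute)
  have "\<not> 4 dvd 4 * k + 1" "\<not> 4 dvd 4 * k + 2" "\<not> 4 dvd 4 * k + 3" "4 dvd 4 * k"
    by presburger+
  then have "B_gf (4 * k + 4) = (1 + B_weight (4 * k + 1)) * (1 + B_weight (4 * k + 2)) *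
      (1 + B_weight (4 * k + 3)) * B_gf (4 * k)"
    using B_gf_Suc [of "4 * k"] B_gf_Suc [of "4 * k + 1"] B_gf_Suc [of "4 * k + 2"] B_gf_Suc [of "4 * k + 3"]
    by (simp only: Suc_eq_plus1 add.assoc one_add_one one_plus_numeral numeral_plus_one arith_simps
      if_True if_False mult_1_left mult_ac)
  moreover have "4 * Suc k = 4 * k + 4" by simp
  ultimately show ?case
    unfolding prod.lessThan_Suc * Suc.IH [symmetric] by (simp only: mult_ac)
qed (simp add: B_gf_0)

theorem theorem1p3:
  fixes n m l :: nat
  shows "count_A n m l = count_B n m l"
proof -
  define a b c Q where "a = mon 1 1 0" and "b = mon 2 0 1" and "c = mon 3 1 0" and "Q = mon 4 0 0"
  \<comment> \<open>With this choice \<open>4 * k > n\<close>, so working modulo \<open>Q^k\<close>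
    keeps the coefficient at \<open>n\<close>.\<close>
  define k where "k = Suc n"
  have "Q \<noteq> 0" by (simp add: Q_def mon_def)
  then have "Q ^ k dvd block_seq a b c Q (k+2) - B_gf (4 * (k+2))"
    using block_seq_product_dvd [of Q k "k+2" a b c] B_gf_eq_prod [of "k+2"]
    by (simp add: a_def b_def c_def Q_def)
  \<comment> \<open>The correction separating \<open>u\<close> from \<open>block_seq\<close>
    vanishes modulo \<open>Q^k\<close>.\<close>
  moreover have "Q ^ k dvd c * Q^(k+1) * block_seq a b c Q (k+1)"
    by (simp add: power_add)
  ultimately have "Q ^ k dvd (block_seq a b c Q (k+2) - B_gf (4 * (k+2))) - c * Q^(k+1) * block_seq a b c Q (k+1)"
    by (rule dvd_diff)
  also have "\<dots> = A_gf (4 * (k+1) + 3) - B_gf (4 * (k+2))"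
    using A_gf_eq_block_seq [of "k+1"] by (simp add: a_def b_def c_def Q_def numeral_2_eq_2)
  finally have "monom 1 (4 * k) dvd A_gf (4 * (k+1) + 3) - B_gf (4 * (k+2))"
    by (simp add: Q_def mon_power) (simp add: mon_def)
  \<comment> \<open>As q is the outermost variable, divisibility by \<open>Q^k\<close> means that
    all outer coefficients below \<open>4 * k\<close> vanish.\<close>
  then have "coeff (A_gf (4 * (k+1) + 3)) n = coeff (B_gf (4 * (k+2))) n"
    unfolding monom_1_dvd_iff' by (simp add: k_def)
  then have "int (count_A n m l) = int (count_B n m l)"
    using coeff_A_gf [of n "4 * (k+1) + 3" m l] coeff_B_gf [of n "4 * (k+2)" m l]
    by (simp add: k_def)
  then show ?thesis by simp
qed

end
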